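(* Let $n$ be a positive integer and let $f:\mathbb{Z}^n\to\mathbb{R}\cup\{+\infty\}$ be a function with $\operatorname{dom} f\neq\emptyset$. Define $\tilde f:\mathbb{Z}^{n+1}\to\mathbb{R}\cup\{+\infty\}$ by $\tilde f(x_0,x)=f(x)$ if $x_0=\pi(x)$, and $\tilde f(x_0,x)=+\infty$ otherwise, where $x_0\in\mathbb{Z}$, $x\in\mathbb{Z}^n$. Then $f$ satisfies (JM$^\natural$-EXC) if and only if $\tilde f$ satisfies (JM-EXC). That is, $f$ is jump M$^\natural$-convex if and only if $\tilde f$ is jump M-convex.
   Context: For a finite index set $N$ and a function $f:\mathbb{Z}^N\to\mathbb{R}\cup\{+\infty\}$, the effective domain is $\operatorname{dom} f=\{x\in\mathbb{Z}^N\mid f(x)<+\infty\}$; it is always assumed to be nonempty. $\mathbf{1}^i$ denotes the $i$th unit vector. For integer vectors $x,y$, let $x\vee y$ and $x\wedge y$ be the componentwise maximum and minimum, and $[x\wedge y,x\vee y]_{\mathbb{Z}}$ the set of integer vectors $z$ with $x\wedge y\le z\le x\vee y$ componentwise. A vector $s\in\mathbb{Z}^N$ is an $(x,y)$-increment if $s=\mathbf{1}^i$ or $s=-\mathbf{1}^i$ for some $i\in N$ and $x+s\in[x\wedge y,x\vee y]_{\mathbb{Z}}$. For $x\in\mathbb{Z}^n$, $\pi(x)\in\{0,1\}$ is the parity of the component sum of $x$: $\pi(x)=0$ if $\sum_i x_i$ is even and $\pi(x)=1$ if it is odd. (JM-EXC): for any $x,y\in\operatorname{dom} f$ and any $(x,y)$-increment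 $s$, there exists an $(x+s,y)$-increment $t$ such that $x+s+t\in\operatorname{dom} f$, $y-s-t\in\operatorname{dom} f$, and $f(x)+f(y)\ge f(x+s+t)+f(y-s-t)$. A function satisfying (JM-EXC) is called jump M-convex. (JM$^\natural$-EXC): for any $x,y\in\operatorname{dom} f$ and any $(x,y)$-increment $s$, (i) or (ii) holds: (i) $x+s\in\operatorname{dom} f$, $y-s\in\operatorname{dom} f$, and $f(x)+f(y)\ge f(x+s)+f(y-s)$; (ii) there exists an $(x+s,y)$-increment $t$ such that $x+s+t\in\operatorname{dom} f$, $y-s-t\in\operatorname{dom} f$, and $f(x)+f(y)\ge f(x+s+t)+f(y-s-t)$. A function satisfying (JM$^\natural$-EXC) is called jump M$^\natural$-convex. For functions on $\mathbb{Z}^{n+1}=\mathbb{Z}\times\mathbb{Z}^n$ the coordinates are indexed by $0,1,\ldots,n$. *)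

theory Defs
  imports "HOL-Analysis.Finite_Cartesian_Product" "HOL-Library.Extended_Real"
begin

text \<open>
  A function \<open>\<int>\<^sup>N \<rightarrow> \<real> \<union> {+\<infinity>}\<close> is an \<open>ereal\<close>-valued function on \<^typ>\<open>int ^ 'n\<close>, with \<open>'n\<close> finite,
  that never takes the value \<open>-\<infinity>\<close>.  The latter is not part of the exchange properties below;
  it is part of \<open>proper\<close>.
\<close>

definition eff_dom :: "(int ^ 'n \<Rightarrow> ereal) \<Rightarrow> (int ^ 'n) set"
  where "eff_dom f = {x. f x < \<infinity>}"

definition proper :: "(int ^ 'n \<Rightarrow> ereal) \<Rightarrow> bool"
  where "proper f \<longleftrightarrow> (\<forall>x. f x \<noteq> -\<infinity>) \<and> eff_dom f \<noteq> {}"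

text \<open>The library provides lattice operations on vectors only over ordered Euclidean spaces,
  hence not over \<^typ>\<open>int\<close>.\<close>

definition vec_join :: "int ^ 'n \<Rightarrow> int ^ 'n \<Rightarrow> int ^ 'n"
  where "vec_join x y = (\<chi> i. max (x $ i) (y $ i))"

definition vec_meet :: "int ^ 'n \<Rightarrow> int ^ 'n \<Rightarrow> int ^ 'n"
  where "vec_meet x y = (\<chi> i. min (x $ i) (y $ i))"

definition increment :: "int ^ 'n \<Rightarrow> int ^ 'n \<Rightarrow> int ^ 'n \<Rightarrow> bool"
  where "increment x y s \<longleftrightarrow>
    (\<exists>i. s = axis i 1 \<or> s = - axis i 1) \<and> x + s \<in> {vec_meet x y .. vec_join x y}"

definition JM_EXC :: "(int ^ 'n \<Rightarrow> ereal) \<Rightarrow> bool"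
  where "JM_EXC f \<longleftrightarrow>
    (\<forall>x \<in> eff_dom f. \<forall>y \<in> eff_dom f. \<forall>s. increment x y s \<longrightarrow>
      (\<exists>t. increment (x + s) y t \<and> x + s + t \<in> eff_dom f \<and> y - s - t \<in> eff_dom f \<and>
           f x + f y \<ge> f (x + s + t) + f (y - s - t)))"

definition JM_nat_EXC :: "(int ^ 'n \<Rightarrow> ereal) \<Rightarrow> bool"
  where "JM_nat_EXC f \<longleftrightarrow>
    (\<forall>x \<in> eff_dom f. \<forall>y \<in> eff_dom f. \<forall>s. increment x y s \<longrightarrow>
      (x + s \<in> eff_dom f \<and> y - s \<in> eff_dom f \<and> f x + f y \<ge> f (x + s) + f (y - s)) \<or>
      (\<exists>t. increment (x + s) y t \<and> x + s + t \<in> eff_dom f \<and> y - s - t \<in> eff_dom f \<and>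
           f x + f y \<ge> f (x + s + t) + f (y - s - t)))"

definition jump_M_convex :: "(int ^ 'n \<Rightarrow> ereal) \<Rightarrow> bool"
  where "jump_M_convex f \<longleftrightarrow> proper f \<and> JM_EXC f"

definition jump_M_nat_convex :: "(int ^ 'n \<Rightarrow> ereal) \<Rightarrow> bool"
  where "jump_M_nat_convex f \<longleftrightarrow> proper f \<and> JM_nat_EXC f"

definition parity :: "int ^ 'n \<Rightarrow> int"
  where "parity x = (if even (\<Sum>i\<in>UNIV. x $ i) then 0 else 1)"

text \<open>\<open>\<int>\<^sup>n\<^sup>+\<^sup>1\<close> is \<^typ>\<open>int ^ 'n option\<close>: \<open>None\<close> is the index \<open>0\<close> and
  \<open>Some i\<close> are the original indices.\<close>

definition parity_lift :: "(int ^ 'n \<Rightarrow> ereal) \<Rightarrow> int ^ 'n option \<Rightarrow> ereal"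
  where "parity_lift f z =
    (let x = (\<chi> i. z $ Some i) in if z $ None = parity x then f x else \<infinity>)"

end

theory Submission
  imports Defs "HOL-Library.Multiset"
begin

text \<open>
  Lifting the graph of parities turns single steps into double steps.  A lifted point has
  coordinate \<open>0\<close> equal to its parity, so an exchange \<open>x + s\<close>, \<open>y - s\<close> of the original function is an
  exchange by \<open>s\<close> and \<open>\<plusminus>\<one>\<^sup>0\<close> of the lifts, provided that \<open>\<plusminus>\<one>\<^sup>0\<close> is an increment, which happens exactly
  when \<open>x\<close> and \<open>y\<close> have different parities; an exchange by \<open>s + t\<close> lifts as it stands.  Reading this
  correspondence backwards proves that (JM-EXC) for the lift implies (JM\<open>\<^sup>\<natural>\<close>-EXC).

  The converse is harder, because (JM\<open>\<^sup>\<natural>\<close>-EXC) may answer with a single step although the parities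
  agree, and it says nothing about the first step \<open>\<plusminus>\<one>\<^sup>0\<close>.  Both problems are solved first
  for lifted points at distance 4, and the general case is reduced to that one.  Below, a point is
  better or worse than another if its (perturbed) value is smaller or larger, and linear
  perturbations are harmless because all exchanges preserve the sum of the two points.

  \<^item> Different parities at distance 4 mean that \<open>x\<close> and \<open>y\<close> are at distance 3.  Here the two answers
    of (JM\<open>\<^sup>\<natural>\<close>-EXC) coincide up to interchanging the two new points, so an exchange by some single
    step exists (\<open>natural_exchange_distance_3\<close>).

  \<^item> If the parities agree, let \<open>y = x + a + b + c + d\<close>.  If no exchange by \<open>a\<close> and a second step
    exists, suitable weights of the four steps make \<open>x\<close> and \<open>y\<close> equally good and every \<open>x +\<close> (two
    steps) in the domain strictly worse.  Then the exchange at distance 3 leads from every \<open>x +\<close> (one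
    step) in the domain to a strictly better \<open>y -\<close> (one step), and back again, which cannot go on for
    ever (\<open>natural_exchange_distance_4\<close>).

  \<^item> \<open>exchange_from_local\<close> passes from distance 4 to all distances, in a set all of whose points have
    even distance and in which one can always move from \<open>y\<close> towards \<open>x\<close> by two steps.  In a
    counterexample \<open>x, y, s\<close> of minimal distance, which is at least 6, a linear perturbation makes
    every \<open>x + s + t\<close> in the set worse than \<open>x\<close> and every \<open>y - s - t\<close> in it worse than \<open>y\<close>.
    Choose the best \<open>y' = y - a - b\<close> in the set that still leaves room for \<open>s\<close>.  The exchange between
    \<open>x\<close> and \<open>y'\<close>, which are closer, shows that some \<open>z = y' - s - t\<close> is better than \<open>y'\<close>, and the
    exchange between \<open>z\<close> and \<open>y\<close>, which are at distance 4, then produces a candidate for \<open>y'\<close> that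
    is better still.

  The exchange properties are treated for a set \<open>D\<close> and a real-valued function \<open>H\<close>, which stand for
  the effective domain and the finite values of the function.
\<close>

section \<open>Increments and geodesics\<close>

text \<open>A unit vector or the negative of one.\<close>
definition unit_step :: "int ^ 'n \<Rightarrow> bool"
  where "unit_step s \<longleftrightarrow> (\<exists>i. s = axis i 1 \<or> s = - axis i 1)"

text \<open>
  The multiset \<open>M\<close> collects the unit steps of a shortest path from \<open>x\<close> to \<open>y\<close>.  Being shortest is
  expressed by never using both a step and its opposite, so that \<open>size M\<close> is the \<open>\<ell>\<^sub>1\<close>-distance.
  The multiset exists, is determined by \<open>x\<close> and \<open>y\<close>, and its elements are the \<open>(x, y)\<close>-increments.
\<close>
definition geodesic :: "int ^ 'n \<Rightarrow> int ^ 'n \<Rightarrow> (int ^ 'n) multiset \<Rightarrow> bool"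
  where "geodesic x y M \<longleftrightarrow> y = x + \<Sum>\<^sub># M \<and> (\<forall>u\<in>#M. unit_step u \<and> - u \<notin># M)"

lemma axis_neq_uminus_axis: "axis i (1::int) \<noteq> - axis j 1"
proof
  assume "axis i (1::int) = - axis j 1"
  then have "axis i (1::int) $ i = (- axis j 1) $ i" by simp
  then show False by (auto simp: axis_def split: if_splits)
qed

lemma axis_one_eq_iff: "axis i (1::int) = axis j 1 \<longleftrightarrow> i = j"
  by (auto simp: axis_eq_axis)

lemma increment_axis_iff: "increment x y (axis i 1) \<longleftrightarrow> x $ i < y $ i"
  unfolding increment_def
proof (intro iffI conjI)
  assume "(\<exists>j. axis i (1::int) = axis j 1 \<or> axis i 1 = - axis j 1) \<and>
    x + axis i 1 \<in> {vec_meet x y..vec_join x y}"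
  then have "(x + axis i 1) $ i \<le> vec_join x y $ i"
    unfolding less_eq_vec_def atLeastAtMost_iff by blast
  then show "x $ i < y $ i" by (auto simp: vec_join_def axis_def)
next
  assume "x $ i < y $ i"
  then show "x + axis i 1 \<in> {vec_meet x y..vec_join x y}"
    by (auto simp: less_eq_vec_def vec_join_def vec_meet_def axis_def)
qed auto

lemma increment_uminus_axis_iff: "increment x y (- axis i 1) \<longleftrightarrow> y $ i < x $ i"
  unfolding increment_def
proof (intro iffI conjI)
  assume "(\<exists>j. - axis i (1::int) = axis j 1 \<or> - axis i 1 = - axis j 1) \<and>
    x + - axis i 1 \<in> {vec_meet x y..vec_join x y}"
  then have "vec_meet x y $ i \<le> (x + - axis i 1) $ i"
    unfolding less_eq_vec_def atLeastAtMost_iff by blast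
  then show "y $ i < x $ i" by (auto simp: vec_meet_def axis_def)
next
  assume "y $ i < x $ i"
  then show "x + - axis i 1 \<in> {vec_meet x y..vec_join x y}"
    by (auto simp: less_eq_vec_def vec_join_def vec_meet_def axis_def)
qed auto

lemma increment_unit_step: "increment x y s \<Longrightarrow> unit_step s"
  by (auto simp: increment_def unit_step_def)

lemma sum_mset_unit_steps_nth:
  assumes "\<forall>u\<in>#M. unit_step u"
  shows "\<Sum>\<^sub># M $ i = int (count M (axis i 1)) - int (count M (- axis i 1))"
  using assms
proof (induction M)
  case (add u M)
  have "u $ i = (if u = axis i 1 then 1 else 0) - (if u = - axis i 1 then 1 else 0)"
  proof -
    obtain j where "u = axis j 1 \<or> u = - axis j 1"
      using add.prems by (auto simp: unit_step_def)
    then show ?thesis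
    proof
      assume u: "u = axis j 1"
      then have "u = axis i 1 \<longleftrightarrow> i = j" "u \<noteq> - axis i 1"
        using axis_neq_uminus_axis[of j i] by (auto simp: axis_one_eq_iff)
      then show ?thesis using u by (simp add: axis_def)
    next
      assume u: "u = - axis j 1"
      then have "u = - axis i 1 \<longleftrightarrow> i = j" "u \<noteq> axis i 1"
        using axis_neq_uminus_axis[of i j] by (auto simp: axis_one_eq_iff)
      then show ?thesis using u by (simp add: axis_def)
    qed
  qed
  then show ?case using add by simp
qed simp

lemma geodesic_nth:
  assumes "geodesic x y M"
  shows "y $ i - x $ i = int (count M (axis i 1)) - int (count M (- axis i 1))"
    and "count M (axis i 1) = 0 \<or> count M (- axis i 1) = 0"
proof -
  show "y $ i - x $ i = int (count M (axis i 1)) - int (count M (- axis i 1))"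
    using assms sum_mset_unit_steps_nth[of M i] by (simp add: geodesic_def)
  have "axis i 1 \<in># M \<Longrightarrow> - axis i 1 \<notin># M" using assms unfolding geodesic_def by blast
  then show "count M (axis i 1) = 0 \<or> count M (- axis i 1) = 0"
    by (meson count_eq_zero_iff)
qed

lemma increment_iff_geodesic:
  assumes "geodesic x y M"
  shows "increment x y s \<longleftrightarrow> s \<in># M"
proof (cases "unit_step s")
  case True
  then obtain i where "s = axis i 1 \<or> s = - axis i 1" by (auto simp: unit_step_def)
  then show ?thesis
    using geodesic_nth[OF assms, of i]
    unfolding count_greater_zero_iff[symmetric]
    by (elim disjE; simp add: increment_axis_iff increment_uminus_axis_iff
        del: count_greater_zero_iff; linarith)
next
  case False
  then show ?thesis using assms by (auto simp: geodesic_def dest: increment_unit_step)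
qed

lemma geodesic_add_mset:
  "geodesic x y (add_mset s M) \<Longrightarrow> geodesic (x + s) y M"
  by (auto simp: geodesic_def algebra_simps)

lemma geodesic_diff_right:
  assumes "geodesic x y M" "N \<subseteq># M"
  shows "geodesic x (y - \<Sum>\<^sub># N) (M - N)"
proof -
  obtain L where M: "M = N + L" using assms(2) by (auto simp: mset_subset_eq_exists_conv)
  show ?thesis using assms(1) by (auto simp: geodesic_def M algebra_simps)
qed

lemma geodesic_inside:
  assumes "geodesic x y M" "N \<subseteq># M"
  shows "geodesic (y - \<Sum>\<^sub># N) y N"
  using assms set_mset_mono[OF assms(2)] unfolding geodesic_def by (auto simp: subset_iff)

lemma geodesic_exists:
  fixes x y :: "int ^ 'n"
  shows "\<exists>M. geodesic x y M"
proof (induction "\<Sum>i\<in>UNIV. nat \<bar>y $ i - x $ i\<bar>" arbitrary: x rule: less_induct)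
  case less
  show ?case
  proof (cases "x = y")
    case True
    then have "geodesic x y {#}" by (simp add: geodesic_def)
    then show ?thesis ..
  next
    case False
    then obtain i where i: "x $ i \<noteq> y $ i" by (auto simp: vec_eq_iff)
    define s :: "int ^ 'n" where "s = (if x $ i < y $ i then axis i 1 else - axis i 1)"
    have "(\<Sum>j\<in>UNIV. nat \<bar>y $ j - (x + s) $ j\<bar>) < (\<Sum>j\<in>UNIV. nat \<bar>y $ j - x $ j\<bar>)"
    proof (rule sum_strict_mono_ex1)
      show "\<forall>j\<in>UNIV. nat \<bar>y $ j - (x + s) $ j\<bar> \<le> nat \<bar>y $ j - x $ j\<bar>"
        using i by (auto simp: s_def axis_def)
      have "nat \<bar>y $ i - (x + s) $ i\<bar> < nat \<bar>y $ i - x $ i\<bar>"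
        using i by (auto simp: s_def axis_def)
      then show "\<exists>j\<in>UNIV. nat \<bar>y $ j - (x + s) $ j\<bar> < nat \<bar>y $ j - x $ j\<bar>" by blast
    qed simp
    then obtain M where M: "geodesic (x + s) y M" using less by blast
    have "\<not> increment (x + s) y (- s)"
      using i by (simp add: s_def increment_axis_iff increment_uminus_axis_iff)
    then have "- s \<notin># M" using increment_iff_geodesic[OF M] by simp
    moreover have "unit_step s" by (auto simp: s_def unit_step_def)
    moreover have "s \<noteq> - s"
      using axis_neq_uminus_axis[of i i] by (auto simp: s_def)
    ultimately have "geodesic x y (add_mset s M)"
      using M by (auto simp: geodesic_def algebra_simps)
    then show ?thesis ..
  qed
qed

lemma geodesic_unique:
  assumes "geodesic x y M" "geodesic x y N"
  shows "M = N"
proof (rule multiset_eqI)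
  fix u
  show "count M u = count N u"
  proof (cases "unit_step u")
    case True
    then obtain i where "u = axis i 1 \<or> u = - axis i 1" by (auto simp: unit_step_def)
    then show ?thesis
      using geodesic_nth[OF assms(1), of i] geodesic_nth[OF assms(2), of i] by auto
  next
    case False
    then show ?thesis using assms by (metis count_eq_zero_iff geodesic_def)
  qed
qed

text \<open>
  Values on the steps of a geodesic can be prescribed freely, since different steps belong to
  different coordinates.
\<close>
lemma linear_functional_exists:
  fixes w :: "int ^ 'n \<Rightarrow> real"
  assumes "geodesic x y M"
  obtains \<phi> :: "int ^ 'n \<Rightarrow> real"
  where "\<And>u v. \<phi> (u + v) = \<phi> u + \<phi> v" "\<And>u v. \<phi> (u - v) = \<phi> u - \<phi> v"
    and "\<And>u. u \<in># M \<Longrightarrow> \<phi> u = w u"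
proof
  define c where "c i = (if axis i 1 \<in># M then w (axis i 1) else - w (- axis i 1))" for i
  let ?\<phi> = "\<lambda>z::int ^ 'n. \<Sum>i\<in>UNIV. c i * real_of_int (z $ i)"
  show "?\<phi> (u + v) = ?\<phi> u + ?\<phi> v" for u v by (simp add: algebra_simps sum.distrib)
  show "?\<phi> (u - v) = ?\<phi> u - ?\<phi> v" for u v by (simp add: algebra_simps sum_subtractf)
  fix u assume u: "u \<in># M"
  then obtain j where j: "u = axis j 1 \<or> u = - axis j 1"
    using assms by (auto simp: geodesic_def unit_step_def)
  have ax: "?\<phi> (axis j 1) = c j"
    by (simp add: axis_def if_distrib cong: if_cong)
  then have "?\<phi> (- axis j 1) = - c j" by (simp add: sum_negf)
  then show "?\<phi> u = w u" using j ax u assms by (auto simp: c_def geodesic_def)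
qed

lemma geodesic_add_mset_right:
  "geodesic x y (add_mset s M) \<Longrightarrow> geodesic x (y - s) M"
  by (auto simp: geodesic_def algebra_simps)

section \<open>Exchange properties of a real function on a set\<close>

text \<open>Moving \<open>x\<close> by \<open>a\<close> and \<open>y\<close> by \<open>- a\<close> stays in \<open>D\<close> and does not increase the sum of the values.\<close>
definition exchangeable ::
    "(int ^ 'n) set \<Rightarrow> (int ^ 'n \<Rightarrow> real) \<Rightarrow> int ^ 'n \<Rightarrow> int ^ 'n \<Rightarrow> int ^ 'n \<Rightarrow> bool"
  where "exchangeable D H x y a \<longleftrightarrow> x + a \<in> D \<and> y - a \<in> D \<and> H (x + a) + H (y - a) \<le> H x + H y"

text \<open>(JM-EXC) and (JM\<open>\<^sup>\<natural>\<close>-EXC), with increments described by geodesics: removing \<open>s\<close> from the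
  geodesic from \<open>x\<close> to \<open>y\<close> gives the geodesic from \<open>x + s\<close> to \<open>y\<close>.\<close>
definition exchange :: "(int ^ 'n) set \<Rightarrow> (int ^ 'n \<Rightarrow> real) \<Rightarrow> bool"
  where "exchange D H \<longleftrightarrow> (\<forall>x\<in>D. \<forall>y\<in>D. \<forall>M. geodesic x y M \<longrightarrow> (\<forall>s\<in>#M.
    \<exists>t\<in>#M - {#s#}. exchangeable D H x y (s + t)))"

definition natural_exchange :: "(int ^ 'n) set \<Rightarrow> (int ^ 'n \<Rightarrow> real) \<Rightarrow> bool"
  where "natural_exchange D H \<longleftrightarrow> (\<forall>x\<in>D. \<forall>y\<in>D. \<forall>M. geodesic x y M \<longrightarrow> (\<forall>s\<in>#M.
    exchangeable D H x y s \<or> (\<exists>t\<in>#M - {#s#}. exchangeable D H x y (s + t))))"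

lemma exchangeable_complement:
  assumes "y = x + a + b"
  shows "exchangeable D H x y a \<longleftrightarrow> exchangeable D H x y b"
proof -
  have "x + a = y - b" "y - a = x + b" using assms by (auto simp: algebra_simps)
  then show ?thesis by (auto simp: exchangeable_def)
qed

text \<open>
  The source of all linear perturbations: if the exchange by \<open>e\<close> fails, some weight \<open>r\<close> of \<open>e\<close> makes
  \<open>x + e\<close> worse than \<open>x\<close> and \<open>y - e\<close> worse than \<open>y\<close>, as far as these points lie in \<open>D\<close>.
\<close>
lemma separating_real_exists:
  assumes "\<not> exchangeable D H x y e"
  shows "\<exists>r. (x + e \<in> D \<longrightarrow> H x < H (x + e) + r) \<and> (y - e \<in> D \<longrightarrow> H y < H (y - e) - r)"
proof -
  consider "x + e \<notin> D" | "y - e \<notin> D" | "H x - H (x + e) < H (y - e) - H y"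
    using assms by (fastforce simp: exchangeable_def)
  then show ?thesis
  proof cases
    case 1
    then show ?thesis by (intro exI[of _ "H (y - e) - H y - 1"]) auto
  next
    case 2
    then show ?thesis by (intro exI[of _ "H x - H (x + e) + 1"]) auto
  next
    case 3
    then obtain r where "H x - H (x + e) < r" "r < H (y - e) - H y"
      using dense by blast
    then show ?thesis by (intro exI[of _ r]) auto
  qed
qed

section \<open>Short distances\<close>

lemma natural_exchangeD:
  assumes "natural_exchange D H" "x \<in> D" "y \<in> D" "geodesic x y M" "s \<in># M"
  shows "exchangeable D H x y s \<or> (\<exists>t\<in>#M - {#s#}. exchangeable D H x y (s + t))"
  using assms unfolding natural_exchange_def by blast

lemma natural_exchange_distance_3:
  assumes "natural_exchange D H" "x \<in> D" "y \<in> D" "geodesic x y {#a, b, c#}"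
  shows "\<exists>t\<in>{a, b, c}. exchangeable D H x y t"
proof -
  have "exchangeable D H x y a \<or> exchangeable D H x y (a + b) \<or> exchangeable D H x y (a + c)"
    using natural_exchangeD[OF assms, of a] by auto
  moreover have "y = x + (a + b) + c" "y = x + (a + c) + b"
    using assms(4) by (auto simp: geodesic_def algebra_simps)
  ultimately show ?thesis using exchangeable_complement by blast
qed

text \<open>
  The four steps may coincide, so the perturbation assigns weights to the indices \<open>0, \<dots>, 3\<close> of the
  steps rather than to the steps themselves.
\<close>
lemma natural_exchange_distance_4:
  assumes "natural_exchange D H" "x \<in> D" "y \<in> D" "geodesic x y {#a, b, c, d#}"
  shows "\<exists>t\<in>{b, c, d}. exchangeable D H x y (a + t)"
proof (rule ccontr)
  assume neg: "\<not> ?thesis"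
  define v where "v i = (if i = 0 then a else if i = 1 then b else if i = 2 then c else d)"
    for i :: nat
  have y: "y = x + (a + b + c + d)" using assms(4) by (simp add: geodesic_def algebra_simps)
  have less_4: "i < 4 \<longleftrightarrow> i = 0 \<or> i = 1 \<or> i = 2 \<or> i = 3" for i :: nat by auto
  define sep where "sep e r \<longleftrightarrow> (x + e \<in> D \<longrightarrow> H x < H (x + e) + r) \<and>
      (y - e \<in> D \<longrightarrow> H y < H (y - e) - r)" for e r
  obtain r1 r2 r3 where r: "sep (a + b) r1" "sep (a + c) r2" "sep (a + d) r3"
  proof -
    have "\<exists>r. sep (a + t) r" if "t \<in> {b, c, d}" for t
    proof -
      have "\<not> exchangeable D H x y (a + t)" using neg that by blast
      then show ?thesis unfolding sep_def by (rule separating_real_exists)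
    qed
    then show ?thesis using that by (meson insertCI)
  qed
  define Q where "Q = H x - H y"
  \<comment> \<open>The weights \<open>q i\<close> have sum \<open>Q\<close>, so that the perturbed values of \<open>x\<close> and \<open>y\<close> agree, and the pairs
    \<open>a + b\<close>, \<open>a + c\<close>, \<open>a + d\<close> get the weights \<open>r1\<close>, \<open>r2\<close>, \<open>r3\<close>.\<close>
  define qa where "qa = (r1 + r2 + r3 - Q) / 2"
  define q where "q i = (if i = 0 then qa else if i = 1 then r1 - qa
      else if i = 2 then r2 - qa else r3 - qa)" for i :: nat
  \<comment> \<open>A pair of indices either belongs to one of these three pairs or is complementary to one.\<close>
  have pair: "\<exists>e r. sep e r \<and> (v i + v j = e \<and> q i + q j = r \<or>
      v i + v j = y - x - e \<and> q i + q j = Q - r)"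
    if ij: "i < 4" "j < 4" "i \<noteq> j" for i j
  proof -
    let ?P = "\<lambda>e r. v i + v j = e \<and> q i + q j = r"
    have "(i, j) \<in> {(0, 1), (1, 0), (0, 2), (2, 0), (0, 3), (3, 0),
        (1, 2), (2, 1), (1, 3), (3, 1), (2, 3), (3, 2)}"
      using ij unfolding less_4 by auto
    then have "?P (a + b) r1 \<or> ?P (c + d) (Q - r1) \<or> ?P (a + c) r2 \<or> ?P (b + d) (Q - r2) \<or>
        ?P (a + d) r3 \<or> ?P (b + c) (Q - r3)"
      unfolding insert_iff empty_iff prod.inject
      by (elim disjE conjE) (simp_all add: v_def q_def qa_def field_simps)
    moreover have "y - x - (a + b) = c + d" "y - x - (a + c) = b + d" "y - x - (a + d) = b + c"
      using y by (auto simp: algebra_simps)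
    ultimately show ?thesis using r by metis
  qed
  have up: "H x < H (x + (v i + v j)) + q i + q j"
    if ij: "i < 4" "j < 4" "i \<noteq> j" "x + (v i + v j) \<in> D" for i j
  proof -
    obtain e r where er: "sep e r" "v i + v j = e \<and> q i + q j = r \<or>
        v i + v j = y - x - e \<and> q i + q j = Q - r"
      using pair ij(1-3) by blast
    have "x + (y - x - e) = y - e" by simp
    then show ?thesis using er ij(4) unfolding sep_def Q_def by (elim disjE conjE) simp_all
  qed
  have down: "H y < H (y - (v i + v j)) - q i - q j"
    if ij: "i < 4" "j < 4" "i \<noteq> j" "y - (v i + v j) \<in> D" for i j
  proof -
    obtain e r where er: "sep e r" "v i + v j = e \<and> q i + q j = r \<or>
        v i + v j = y - x - e \<and> q i + q j = Q - r"
      using pair ij(1-3) by blast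
    have "y - (y - x - e) = x + e" by simp
    then show ?thesis using er ij(4) unfolding sep_def Q_def by (elim disjE conjE) simp_all
  qed
  have geo: "\<exists>j k l. {j, k, l} \<subseteq> {..<4} - {i} \<and> geodesic x y {#v i, v j, v k, v l#}"
    if "i < 4" for i
  proof -
    have g: "geodesic x y {#v 0, v 1, v 2, v 3#}" using assms(4) by (simp add: v_def)
    have "{#v 1, v 0, v 2, v 3#} = {#v 0, v 1, v 2, v 3#}"
      "{#v 2, v 0, v 1, v 3#} = {#v 0, v 1, v 2, v 3#}"
      "{#v 3, v 0, v 1, v 2#} = {#v 0, v 1, v 2, v 3#}"
      by (simp_all only: add_mset_commute)
    with g have g': "geodesic x y {#v 1, v 0, v 2, v 3#}" "geodesic x y {#v 2, v 0, v 1, v 3#}"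
      "geodesic x y {#v 3, v 0, v 1, v 2#}" by (simp_all only:)
    have "{1, 2, 3} \<subseteq> {..<4} - {0 :: nat}" "{0, 2, 3} \<subseteq> {..<4} - {1 :: nat}"
      "{0, 1, 3} \<subseteq> {..<4} - {2 :: nat}" "{0, 1, 2} \<subseteq> {..<4} - {3 :: nat}" by auto
    moreover have "i = 0 \<or> i = 1 \<or> i = 2 \<or> i = 3" using \<open>i < 4\<close> less_4 by blast
    ultimately show ?thesis using g g' by (elim disjE) (simp only:, blast)+
  qed
  \<comment> \<open>In perturbed values, \<open>x + v i\<close> has \<open>H (x + v i) + q i\<close> and \<open>y - v j\<close> has \<open>H (y - v j) + Q - q j\<close>.\<close>
  have single_to_triple: "\<exists>j<4. y - v j \<in> D \<and> H (y - v j) + Q - q j < H (x + v i) + q i"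
    if i: "i < 4" "x + v i \<in> D" for i
  proof -
    obtain j k l where jkl: "{j, k, l} \<subseteq> {..<4} - {i}" "geodesic x y {#v i, v j, v k, v l#}"
      using geo i by blast
    have "\<exists>u\<in>v ` {j, k, l}. exchangeable D H (x + v i) y u"
      using natural_exchange_distance_3[OF assms(1) i(2) assms(3) geodesic_add_mset[OF jkl(2)]]
      by (simp only: image_insert image_empty)
    then obtain t where "t \<in> {j, k, l}" and ex: "exchangeable D H (x + v i) y (v t)" by blast
    then have t: "t < 4" "i \<noteq> t" using jkl by auto
    then show ?thesis using up[of i t] ex i
      by (intro exI[of _ t]) (auto simp: exchangeable_def Q_def add.assoc)
  qed
  have triple_to_single: "\<exists>j<4. x + v j \<in> D \<and> H (x + v j) + q j < H (y - v i) + Q - q i"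
    if i: "i < 4" "y - v i \<in> D" for i
  proof -
    obtain j k l where jkl: "{j, k, l} \<subseteq> {..<4} - {i}" "geodesic x y {#v i, v j, v k, v l#}"
      using geo i by blast
    have "\<exists>u\<in>v ` {j, k, l}. exchangeable D H x (y - v i) u"
      using natural_exchange_distance_3[OF assms(1,2) i(2) geodesic_add_mset_right[OF jkl(2)]]
      by (simp only: image_insert image_empty)
    then obtain t where "t \<in> {j, k, l}" and ex: "exchangeable D H x (y - v i) (v t)" by blast
    then have t: "t < 4" "i \<noteq> t" using jkl by auto
    then show ?thesis using down[of i t] ex i
      by (intro exI[of _ t]) (auto simp: exchangeable_def Q_def diff_diff_eq)
  qed
  \<comment> \<open>As no exchange by \<open>a\<close> and a second step exists, \<open>x + a\<close> lies in the domain and starts the descent.\<close>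
  have "exchangeable D H x y a"
    using natural_exchangeD[OF assms, of a] neg by auto
  then have "0 \<in> {i. i < 4 \<and> x + v i \<in> D}" by (simp add: exchangeable_def v_def)
  then have "{i. i < 4 \<and> x + v i \<in> D} \<noteq> {}" by blast
  then obtain i where i: "i < 4" "x + v i \<in> D"
    and min: "\<And>j. j < 4 \<Longrightarrow> x + v j \<in> D \<Longrightarrow> \<not> H (x + v j) + q j < H (x + v i) + q i"
    using arg_min_if_finite[of "{i. i < 4 \<and> x + v i \<in> D}" "\<lambda>i. H (x + v i) + q i"] by auto
  obtain j where j: "j < 4" "y - v j \<in> D" "H (y - v j) + Q - q j < H (x + v i) + q i"
    using single_to_triple[OF i] by blast
  obtain k where k: "k < 4" "x + v k \<in> D" "H (x + v k) + q k < H (y - v j) + Q - q j"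
    using triple_to_single[OF j(1,2)] by blast
  show False using min[OF k(1,2)] k(3) j(3) by linarith
qed

section \<open>From distance 4 to arbitrary distances\<close>

lemma exchange_from_local:
  fixes D :: "(int ^ 'n) set"
  assumes even_dist: "\<And>x y M. \<lbrakk>x \<in> D; y \<in> D; geodesic x y M\<rbrakk> \<Longrightarrow> even (size M)"
    and local: "\<And>x y M s. \<lbrakk>x \<in> D; y \<in> D; geodesic x y M; size M = 4; s \<in># M\<rbrakk> \<Longrightarrow>
      \<exists>t\<in>#M - {#s#}. exchangeable D H x y (s + t)"
    and descent: "\<And>x y M. \<lbrakk>x \<in> D; y \<in> D; geodesic x y M; M \<noteq> {#}\<rbrakk> \<Longrightarrow>
      \<exists>a b. {#a, b#} \<subseteq># M \<and> y - (a + b) \<in> D"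
    and "x \<in> D" "y \<in> D" "geodesic x y M" "s \<in># M"
  shows "\<exists>t\<in>#M - {#s#}. exchangeable D H x y (s + t)"
proof -
  have local_4: "\<exists>t\<in>{b, c, d}. exchangeable D H p q (a + t)"
    if "p \<in> D" "q \<in> D" "geodesic p q {#a, b, c, d#}" for p q a b c d
    using local[OF that, of a] by auto
  show ?thesis
    using assms(4-7)
  proof (induction "size M" arbitrary: x y M s rule: less_induct)
    case less
    note xy = less.prems(1,2) and M = less.prems(3) and s = less.prems(4)
    consider "size M = 2" | "size M = 4" | "6 \<le> size M"
    proof -
      have "even (size M)" "size M \<noteq> 0" using even_dist[OF xy M] s by auto
      then have "size M = 2 \<or> size M = 4 \<or> 6 \<le> size M" by presburger
      then show ?thesis using that by blast
    qed
    then show ?case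
    proof cases
      case 1
      then obtain t where t: "M = {#s, t#}"
        using s by (metis One_nat_def Suc_1 insert_DiffM size_1_singleton_mset
            size_Diff_singleton diff_Suc_1)
      then have "x + (s + t) = y" "y - (s + t) = x" using M by (auto simp: geodesic_def)
      then have "exchangeable D H x y (s + t)" using xy by (simp add: exchangeable_def)
      then show ?thesis using t by simp
    next
      case 2
      then show ?thesis using local[OF xy M] s by blast
    next
      case 3
      show ?thesis
      proof (rule ccontr)
        assume neg: "\<not> ?thesis"
        have "\<exists>r. (x + (s + t) \<in> D \<longrightarrow> H x < H (x + (s + t)) + r) \<and>
            (y - (s + t) \<in> D \<longrightarrow> H y < H (y - (s + t)) - r)" if "t \<in># M - {#s#}" for t
          using neg that separating_real_exists by blast
        then obtain r where
          r: "\<And>t. \<lbrakk>t \<in># M - {#s#}; x + (s + t) \<in> D\<rbrakk> \<Longrightarrow> H x < H (x + (s + t)) + r t"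
            "\<And>t. \<lbrakk>t \<in># M - {#s#}; y - (s + t) \<in> D\<rbrakk> \<Longrightarrow> H y < H (y - (s + t)) - r t"
          by metis
        \<comment> \<open>The values are chosen such that \<open>\<phi> s + \<phi> t = r t\<close>, including the case \<open>t = s\<close>.\<close>
        obtain \<phi> :: "int ^ 'n \<Rightarrow> real"
          where \<phi>: "\<And>u v. \<phi> (u + v) = \<phi> u + \<phi> v" "\<And>u v. \<phi> (u - v) = \<phi> u - \<phi> v"
            and \<phi>_M: "\<And>u. u \<in># M \<Longrightarrow> \<phi> u = r u - r s / 2"
          using linear_functional_exists[OF M, of "\<lambda>u. r u - r s / 2"] by metis
        define K where "K z = H z + \<phi> z" for z
        have \<phi>_st: "\<phi> s + \<phi> t = r t" if "t \<in># M - {#s#}" for t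
          using \<phi>_M[OF s] \<phi>_M[OF in_diffD[OF that]] by simp
        have K_x: "K x < K (x + (s + t))" if "t \<in># M - {#s#}" "x + (s + t) \<in> D" for t
          using r(1)[OF that] \<phi>_st[OF that(1)] by (simp add: K_def \<phi>)
        have K_y: "K y < K (y - (s + t))" if "t \<in># M - {#s#}" "y - (s + t) \<in> D" for t
          using r(2)[OF that] \<phi>_st[OF that(1)] by (simp add: K_def \<phi>)
        have K_exch: "K (p + a) + K (q - a) \<le> K p + K q" if "exchangeable D H p q a" for p q a
          using that by (simp add: exchangeable_def K_def \<phi>)
        \<comment> \<open>\<open>C\<close> is the set of pairs of steps from \<open>y\<close> towards \<open>x\<close> after which \<open>s\<close> is still available.\<close>
        define C where "C = {(a, b). {#s, a, b#} \<subseteq># M \<and> y - (a + b) \<in> D}"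
        have "C \<noteq> {}"
        proof -
          obtain a b where ab: "{#a, b#} \<subseteq># M" "y - (a + b) \<in> D"
            using descent[OF xy M] s by force
          obtain L where L: "M = {#a, b#} + L"
            using ab(1) by (auto simp: mset_subset_eq_exists_conv)
          show ?thesis
          proof (cases "s \<in># L")
            case True
            then obtain L' where "L = add_mset s L'" by (metis insert_DiffM)
            then have "(a, b) \<in> C" using ab(2) L by (simp add: C_def)
            then show ?thesis by blast
          next
            case False
            \<comment> \<open>If the two steps use up \<open>s\<close>, two more steps followed by a local
              exchange by \<open>s\<close> restore it.\<close>
            then have "s = a \<or> s = b" using s L by auto
            then obtain b' where b': "M = {#s, b'#} + L" "y - (s + b') \<in> D"
              using L ab(2) by (auto simp: add.commute)
            have L_geo: "geodesic x (y - (s + b')) L"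
              using geodesic_diff_right[OF M, of "{#s, b'#}"] b'(1) by simp
            have "L \<noteq> {#}" using 3 b'(1) by auto
            then obtain c d where cd: "{#c, d#} \<subseteq># L" "y - (s + b') - (c + d) \<in> D"
              using descent[OF xy(1) b'(2) L_geo] by blast
            obtain N where N: "M = {#s, b', c, d#} + N"
              using cd(1) b'(1) by (auto simp: mset_subset_eq_exists_conv)
            have "geodesic (y - (s + b') - (c + d)) y {#s, b', c, d#}"
              using geodesic_inside[OF M, of "{#s, b', c, d#}"] N by (simp add: algebra_simps)
            then obtain t where t: "t \<in> {b', c, d}" "y - (s + b') - (c + d) + (s + t) \<in> D"
              using local_4[OF cd(2) xy(2)] unfolding exchangeable_def by blast
            have "(c, d) \<in> C \<or> (b', d) \<in> C \<or> (b', c) \<in> C"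
              using t N by (auto simp: C_def algebra_simps)
            then show ?thesis by blast
          qed
        qed
        have "C \<subseteq> set_mset M \<times> set_mset M"
          by (auto simp: C_def dest!: set_mset_mono)
        then have "finite C" by (rule finite_subset) simp
        then obtain p where p: "p \<in> C"
          "\<And>p'. p' \<in> C \<Longrightarrow> \<not> K (y - (fst p' + snd p')) < K (y - (fst p + snd p))"
          using arg_min_if_finite[OF _ \<open>C \<noteq> {}\<close>, of "\<lambda>p. K (y - (fst p + snd p))"] by blast
        obtain a b where "p = (a, b)" by (cases p)
        then have ab: "(a, b) \<in> C"
          and min: "\<And>a' b'. (a', b') \<in> C \<Longrightarrow> \<not> K (y - (a' + b')) < K (y - (a + b))"
          using p(1) p(2)[of "(a', b')" for a' b'] by simp_all
        obtain L where L: "M = {#s, a, b#} + L"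
          using ab by (auto simp: C_def mset_subset_eq_exists_conv)
        have "geodesic x (y - (a + b)) (add_mset s L)"
          using geodesic_diff_right[OF M, of "{#a, b#}"] L by simp
        moreover have "y - (a + b) \<in> D" using ab by (simp add: C_def)
        ultimately obtain t where t: "t \<in># L" "exchangeable D H x (y - (a + b)) (s + t)"
          using less.hyps[of "add_mset s L" x "y - (a + b)" s] xy L by auto
        define z where "z = y - (a + b) - (s + t)"
        have z: "z \<in> D" and "x + (s + t) \<in> D" using t(2) by (auto simp: exchangeable_def z_def)
        then have K_z: "K z < K (y - (a + b))"
          using K_exch[OF t(2)] K_x[of t] t(1) L by (simp add: z_def)
        obtain N where N: "M = {#s, a, b, t#} + N"
          using t(1) L by (auto dest!: multi_member_split)
        have "geodesic z y {#s, a, b, t#}"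
          using geodesic_inside[OF M, of "{#s, a, b, t#}"] N by (simp add: z_def algebra_simps)
        then obtain u where u: "u \<in> {a, b, t}" "exchangeable D H z y (s + u)"
          using local_4[OF z xy(2)] by blast
        then have "K y < K (y - (s + u))"
          using K_y[of u] N by (auto simp: exchangeable_def)
        then have "K (z + (s + u)) < K (y - (a + b))"
          using K_exch[OF u(2)] K_z by simp
        moreover have "\<exists>a' b'. (a', b') \<in> C \<and> z + (s + u) = y - (a' + b')"
        proof -
          have "z + (s + u) \<in> D" using u(2) by (simp add: exchangeable_def)
          then have "u = a \<Longrightarrow> (b, t) \<in> C \<and> z + (s + u) = y - (b + t)"
            "u = b \<Longrightarrow> (a, t) \<in> C \<and> z + (s + u) = y - (a + t)"
            "u = t \<Longrightarrow> (a, b) \<in> C \<and> z + (s + u) = y - (a + b)"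
            using N by (auto simp: C_def z_def algebra_simps)
          then show ?thesis using u(1) by blast
        qed
        ultimately show False using min by metis
      qed
    qed
  qed
qed

section \<open>The parity lift\<close>

text \<open>
  Two steps from \<open>y\<close> towards \<open>x\<close> are possible inside \<open>D\<close>.  If the exchange property yields a single
  step and then two steps, the exchange at distance 3 over these three steps removes one of them.
\<close>
lemma natural_exchange_descent:
  assumes nat: "natural_exchange D H" and "x \<in> D" "y \<in> D" "geodesic x y M"
    and "M \<noteq> {#}" "even (size M)"
  shows "\<exists>a b. {#a, b#} \<subseteq># M \<and> y - (a + b) \<in> D"
proof -
  obtain s L where L: "M = add_mset s L" using assms(5) by (meson multiset_cases)
  consider "exchangeable D H x y s" | t where "t \<in># L" "exchangeable D H x y (s + t)"
    using natural_exchangeD[OF assms(1-4), of s] L by auto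
  then show ?thesis
  proof cases
    case 1
    then have ys: "y - s \<in> D" by (simp add: exchangeable_def)
    have geo: "geodesic x (y - s) L" using assms(4) L geodesic_add_mset_right by blast
    have "L \<noteq> {#}" using assms(6) L by auto
    then obtain u N where N: "L = add_mset u N" by (meson multiset_cases)
    consider "exchangeable D H x (y - s) u" |
      v where "v \<in># N" "exchangeable D H x (y - s) (u + v)"
      using natural_exchangeD[OF assms(1,2) ys geo, of u] N by auto
    then show ?thesis
    proof cases
      case 1
      then have "y - (s + u) \<in> D" by (simp add: exchangeable_def diff_diff_eq)
      moreover have "{#s, u#} \<subseteq># M" using L N by simp
      ultimately show ?thesis by blast
    next
      case 2
      then obtain P where "N = add_mset v P" by (meson mset_add)
      with L N have M: "M = {#s, u, v#} + P" by simp
      have z: "y - (s + u + v) \<in> D"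
        using 2 by (simp add: exchangeable_def diff_diff_eq add.assoc)
      have "geodesic (y - (s + u + v)) y {#s, u, v#}"
        using geodesic_inside[OF assms(4), of "{#s, u, v#}"] M by (simp add: add.assoc)
      then obtain t where t: "t \<in> {s, u, v}" "y - (s + u + v) + t \<in> D"
        using natural_exchange_distance_3[OF nat z assms(3)] unfolding exchangeable_def by blast
      have "{#s, u#} \<subseteq># M" "{#s, v#} \<subseteq># M" "{#u, v#} \<subseteq># M" using M by simp_all
      moreover have "y - (s + u + v) + s = y - (u + v)" "y - (s + u + v) + u = y - (s + v)"
        "y - (s + u + v) + v = y - (s + u)" by (simp_all add: algebra_simps)
      ultimately show ?thesis using t by (elim insertE emptyE; simp only:; blast)
    qed
  next
    case 2
    then have "{#s, t#} \<subseteq># M" using L by simp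
    then show ?thesis using 2 by (auto simp: exchangeable_def)
  qed
qed

text \<open>The point \<open>(e, x)\<close>, with the coordinate \<open>None\<close> in the role of the index \<open>0\<close>.\<close>
definition lift :: "int \<Rightarrow> int ^ 'n \<Rightarrow> int ^ 'n option"
  where "lift e x = (\<chi> j. case j of None \<Rightarrow> e | Some i \<Rightarrow> x $ i)"

text \<open>The projection that forgets the coordinate \<open>0\<close>.\<close>
definition drop0 :: "int ^ 'n option \<Rightarrow> int ^ 'n"
  where "drop0 z = (\<chi> i. z $ Some i)"

lemma lift_nth [simp]: "lift e x $ None = e" "lift e x $ Some i = x $ i"
  by (simp_all add: lift_def)

lemma drop0_lift [simp]: "drop0 (lift e x) = x"
  by (simp add: drop0_def vec_eq_iff)

lemma vec_option_eq_iff: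
  fixes z w :: "'a ^ ('n::finite) option"
  shows "z = w \<longleftrightarrow> z $ None = w $ None \<and> (\<forall>i. z $ Some i = w $ Some i)"
  unfolding vec_eq_iff by (metis option.exhaust)

lemma lift_eq_iff [simp]: "lift e x = lift e' x' \<longleftrightarrow> e = e' \<and> x = x'"
  by (auto simp: vec_option_eq_iff vec_eq_iff)

lemma lift_drop0: "lift (z $ None) (drop0 z) = z"
  by (simp add: vec_option_eq_iff drop0_def)

lemma lift_add: "lift e x + lift e' x' = lift (e + e') (x + x')"
  and lift_diff: "lift e x - lift e' x' = lift (e - e') (x - x')"
  and lift_uminus: "- lift e x = lift (- e) (- x)"
  and lift_zero: "lift 0 0 = 0"
  by (simp_all add: vec_option_eq_iff)

lemma lift_axis: "lift 0 (axis i 1) = axis (Some i) 1" "lift 1 0 = axis None 1"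
  by (simp_all add: vec_option_eq_iff axis_def)

lemma unit_step_lift:
  assumes "unit_step u"
  shows "unit_step (lift 0 u)"
proof -
  obtain i where "u = axis i 1 \<or> u = - axis i 1" using assms by (auto simp: unit_step_def)
  then have "lift 0 u = axis (Some i) 1 \<or> lift 0 u = - axis (Some i) 1"
    using lift_axis(1)[of i] lift_uminus[of 0 "axis i 1"] by auto
  then show ?thesis unfolding unit_step_def by blast
qed

lemma unit_step_lift_0:
  assumes "\<bar>e\<bar> = 1"
  shows "unit_step (lift e 0)"
proof -
  have "e = 1 \<or> e = - 1" using assms by auto
  then have "lift e 0 = axis None 1 \<or> lift e 0 = - axis None 1"
    by (simp add: lift_uminus flip: lift_axis(2))
  then show ?thesis unfolding unit_step_def by blast
qed

lemma unit_step_neq_0: "unit_step u \<Longrightarrow> u \<noteq> 0"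
  by (auto simp: unit_step_def)

lemma unit_step_uminus: "unit_step u \<Longrightarrow> unit_step (- u)"
  by (auto simp: unit_step_def)

lemma sum_mset_lift: "\<Sum>\<^sub># (image_mset (lift 0) M) = lift 0 (\<Sum>\<^sub># M)"
  by (induction M) (simp_all add: lift_zero lift_add)

lemma parity_cases: "parity x = 0 \<or> parity x = 1"
  by (simp add: parity_def)

lemma parity_add_unit_step:
  assumes "unit_step s"
  shows "parity (x + s) = 1 - parity x"
proof -
  obtain i where "s = axis i 1 \<or> s = - axis i 1" using assms by (auto simp: unit_step_def)
  moreover have "(\<Sum>j\<in>UNIV. axis i (1::int) $ j) = 1" by (simp add: axis_def)
  ultimately have "odd (\<Sum>j\<in>UNIV. s $ j)" by (auto simp: sum_negf)
  then show ?thesis by (simp add: parity_def sum.distrib)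
qed

lemma parity_diff_unit_step: "unit_step s \<Longrightarrow> parity (x - s) = 1 - parity x"
  using parity_add_unit_step[OF unit_step_uminus, of s x] by simp

lemma parity_two_unit_steps:
  assumes "unit_step s" "unit_step t"
  shows "parity (x + (s + t)) = parity x" "parity (x - (s + t)) = parity x"
  using assms by (simp_all add: parity_add_unit_step parity_diff_unit_step
      flip: add.assoc diff_diff_eq)

lemma geodesic_unit_step: "geodesic x y M \<Longrightarrow> u \<in># M \<Longrightarrow> unit_step u"
  by (simp add: geodesic_def)

lemma parity_eq_iff_even_geodesic:
  assumes "geodesic x y M"
  shows "parity x = parity y \<longleftrightarrow> even (size M)"
proof -
  have "parity (x + \<Sum>\<^sub># M) = (if even (size M) then parity x else 1 - parity x)"
    if "\<forall>u\<in>#M. unit_step u" for M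
    using that
  proof (induction M)
    case (add u M)
    have "parity (x + \<Sum>\<^sub># (add_mset u M)) = parity (x + \<Sum>\<^sub># M + u)"
      by (simp add: algebra_simps)
    also have "\<dots> = 1 - parity (x + \<Sum>\<^sub># M)" using add.prems by (simp add: parity_add_unit_step)
    finally show ?case using add by simp
  qed simp
  from this[of M] assms parity_cases[of x] show ?thesis by (auto simp: geodesic_def)
qed

lemma geodesic_lift:
  assumes "geodesic x y M"
  shows "geodesic (lift (parity x) x) (lift (parity y) y) (image_mset (lift 0) M +
    (if parity x = parity y then {#} else {#lift (parity y - parity x) 0#}))" (is "geodesic _ _ ?N")
  unfolding geodesic_def
proof (intro conjI ballI)
  have y: "y = x + \<Sum>\<^sub># M" using assms by (simp add: geodesic_def)
  show "lift (parity y) y = lift (parity x) x + \<Sum>\<^sub># ?N"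
    by (simp add: sum_mset_lift lift_add y)
  fix w assume w: "w \<in># ?N"
  have e: "\<bar>parity y - parity x\<bar> = 1" if "parity x \<noteq> parity y"
    using that parity_cases[of x] parity_cases[of y] by auto
  show "unit_step w"
    using w assms e
    by (auto simp: geodesic_def intro: unit_step_lift unit_step_lift_0 split: if_splits)
  show "- w \<notin># ?N"
    using w assms e
    by (auto simp: geodesic_def lift_uminus dest!: unit_step_neq_0 split: if_splits)
qed

lemma geodesic_liftE:
  assumes "geodesic (lift (parity x) x) (lift (parity y) y) N"
  obtains M where "geodesic x y M" "N = image_mset (lift 0) M +
    (if parity x = parity y then {#} else {#lift (parity y - parity x) 0#})"
proof -
  obtain M where "geodesic x y M" using geodesic_exists by blast
  then show ?thesis using that geodesic_unique[OF assms geodesic_lift] by blast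
qed

text \<open>The points \<open>(\<pi>(x), x)\<close> with \<open>x\<close> in \<open>D\<close>.\<close>
definition lift_set :: "(int ^ 'n) set \<Rightarrow> (int ^ 'n option) set"
  where "lift_set D = (\<lambda>x. lift (parity x) x) ` D"

lemma lift_in_lift_set_iff: "lift e x \<in> lift_set D \<longleftrightarrow> x \<in> D \<and> e = parity x"
  by (auto simp: lift_set_def)

text \<open>The two equations say that the new points again carry their parities as coordinate \<open>0\<close>.\<close>
lemma exchangeable_lift_iff:
  "exchangeable (lift_set D) (H \<circ> drop0) (lift x0 x) (lift y0 y) (lift e a) \<longleftrightarrow>
    exchangeable D H x y a \<and> x0 + e = parity (x + a) \<and> y0 - e = parity (y - a)"
  by (auto simp: exchangeable_def lift_add lift_diff lift_in_lift_set_iff)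

lemma size_3_mset:
  assumes "size M = 3"
  shows "\<exists>b c d. M = {#b, c, d#}"
proof -
  obtain b L where bL: "M = add_mset b L" "size L = 2"
    using size_eq_Suc_imp_eq_union[of M 2] assms by auto
  then obtain c L' where cL': "L = add_mset c L'" "size L' = 1"
    using size_eq_Suc_imp_eq_union[of L 1] by auto
  then obtain d where "L' = {#d#}" using size_1_singleton_mset by blast
  then show ?thesis using bL cL' by blast
qed

text \<open>
  If the parities differ, the extra coordinate may move either as the first step \<open>s'\<close> or as the
  completing step \<open>t'\<close>: an exchange by one step of \<open>x\<close> is an exchange by two steps of its lift.
  Only when the parities agree, so that \<open>x\<close> and \<open>y\<close> are at distance 4, is the argument of
  \<open>natural_exchange_distance_4\<close> needed.
\<close>
lemma natural_exchange_lift_local: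
  assumes nat: "natural_exchange D H" and x: "x \<in> D" and y: "y \<in> D"
    and N: "geodesic (lift (parity x) x) (lift (parity y) y) N" "size N = 4" and s': "s' \<in># N"
  shows "\<exists>t'\<in>#N - {#s'#}. exchangeable (lift_set D) (H \<circ> drop0)
    (lift (parity x) x) (lift (parity y) y) (s' + t')"
proof -
  obtain M where M: "geodesic x y M" and N_eq: "N = image_mset (lift 0) M +
      (if parity x = parity y then {#} else {#lift (parity y - parity x) 0#})"
    using geodesic_liftE[OF N(1)] .
  note unit = geodesic_unit_step[OF M]
  show ?thesis
  proof (cases "parity x = parity y")
    case True
    then obtain s where s: "s' = lift 0 s" "s \<in># M" using s' N_eq by auto
    then obtain L where L: "M = add_mset s L" by (meson mset_add)
    have "size L = 3" using N(2) N_eq True L by simp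
    then obtain b c d where L_eq: "L = {#b, c, d#}" using size_3_mset by blast
    obtain t where t: "t \<in># L" "exchangeable D H x y (s + t)"
      using natural_exchange_distance_4[OF nat x y, of s b c d] M L L_eq by auto
    have "lift 0 t \<in># N - {#s'#}" using t(1) s(1) N_eq True L by simp
    moreover have "exchangeable (lift_set D) (H \<circ> drop0)
        (lift (parity x) x) (lift (parity y) y) (s' + lift 0 t)"
      using t s unit[of s] unit[of t] L
      by (simp add: lift_add exchangeable_lift_iff parity_two_unit_steps)
    ultimately show ?thesis by blast
  next
    case False
    let ?e = "parity y - parity x"
    have par: "parity y = 1 - parity x" using False parity_cases[of x] parity_cases[of y] by auto
    have N_eq: "N = add_mset (lift ?e 0) (image_mset (lift 0) M)" using N_eq False by simp
    consider "s' = lift ?e 0" | s where "s' = lift 0 s" "s \<in># M" using s' N_eq by auto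
    then show ?thesis
    proof cases
      case 1
      have "size M = 3" using N(2) N_eq by simp
      then obtain b c d where M_eq: "M = {#b, c, d#}" using size_3_mset by blast
      obtain t where t: "t \<in># M" "exchangeable D H x y t"
        using natural_exchange_distance_3[OF nat x y, of b c d] M M_eq by auto
      have "lift 0 t \<in># N - {#s'#}" using t(1) 1 N_eq by simp
      moreover have "exchangeable (lift_set D) (H \<circ> drop0)
          (lift (parity x) x) (lift (parity y) y) (s' + lift 0 t)"
        using t 1 unit[of t] par
        by (simp add: lift_add exchangeable_lift_iff parity_add_unit_step parity_diff_unit_step)
      ultimately show ?thesis by blast
    next
      case 2
      then obtain L where L: "M = add_mset s L" by (meson mset_add)
      have rest: "N - {#s'#} = add_mset (lift ?e 0) (image_mset (lift 0) L)"
        using N_eq L 2(1) by simp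
      consider "exchangeable D H x y s" | t where "t \<in># L" "exchangeable D H x y (s + t)"
        using natural_exchangeD[OF nat x y M 2(2)] L by auto
      then show ?thesis
      proof cases
        case 1
        then have "exchangeable (lift_set D) (H \<circ> drop0)
            (lift (parity x) x) (lift (parity y) y) (s' + lift ?e 0)"
          using 2 unit[of s] par
          by (simp add: lift_add exchangeable_lift_iff parity_add_unit_step parity_diff_unit_step)
        then show ?thesis using rest by simp
      next
        case (2 t)
        then have "exchangeable (lift_set D) (H \<circ> drop0)
            (lift (parity x) x) (lift (parity y) y) (s' + lift 0 t)"
          using \<open>s' = lift 0 s\<close> unit[of s] unit[of t] L
          by (simp add: lift_add exchangeable_lift_iff parity_two_unit_steps)
        then show ?thesis using rest 2(1) by auto
      qed
    qed
  qed
qed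

lemma natural_exchange_lift_descent:
  assumes nat: "natural_exchange D H" and x: "x \<in> D" and y: "y \<in> D"
    and N: "geodesic (lift (parity x) x) (lift (parity y) y) N" "N \<noteq> {#}"
  shows "\<exists>a b. {#a, b#} \<subseteq># N \<and> lift (parity y) y - (a + b) \<in> lift_set D"
proof -
  obtain M where M: "geodesic x y M" and N_eq: "N = image_mset (lift 0) M +
      (if parity x = parity y then {#} else {#lift (parity y - parity x) 0#})"
    using geodesic_liftE[OF N(1)] .
  note unit = geodesic_unit_step[OF M]
  have two: ?thesis if "{#a, b#} \<subseteq># M" "y - (a + b) \<in> D" for a b
  proof -
    have "a \<in># M" "b \<in># M" using set_mset_mono[OF that(1)] by auto
    then have "lift (parity y) y - (lift 0 a + lift 0 b) \<in> lift_set D"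
      using that(2) unit
      by (simp add: lift_add lift_diff lift_in_lift_set_iff parity_two_unit_steps)
    moreover have "{#lift 0 a, lift 0 b#} \<subseteq># N"
      using image_mset_subseteq_mono[OF that(1), of "lift 0"] unfolding N_eq
      by (simp add: subset_mset.add_increasing2)
    ultimately show ?thesis by blast
  qed
  show ?thesis
  proof (cases "parity x = parity y")
    case True
    then have "M \<noteq> {#}" "even (size M)"
      using N(2) N_eq parity_eq_iff_even_geodesic[OF M] by auto
    then show ?thesis using natural_exchange_descent[OF nat x y M] two by blast
  next
    case False
    let ?e = "parity y - parity x"
    have par: "parity y = 1 - parity x" using False parity_cases[of x] parity_cases[of y] by auto
    have "M \<noteq> {#}" using False M by (auto simp: geodesic_def)
    then obtain s L where L: "M = add_mset s L" by (meson multiset_cases)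
    consider "exchangeable D H x y s" | t where "t \<in># L" "exchangeable D H x y (s + t)"
      using natural_exchangeD[OF nat x y M, of s] L by auto
    then show ?thesis
    proof cases
      case 1
      then have "lift (parity y) y - (lift 0 s + lift ?e 0) \<in> lift_set D"
        using unit[of s] L par
        by (simp add: exchangeable_def lift_add lift_diff lift_in_lift_set_iff parity_diff_unit_step)
      moreover have "{#lift 0 s, lift ?e 0#} \<subseteq># N" using N_eq False L by simp
      ultimately show ?thesis by blast
    next
      case 2
      then have "{#s, t#} \<subseteq># M" using L by simp
      then show ?thesis using two 2 by (simp add: exchangeable_def)
    qed
  qed
qed

lemma natural_exchange_iff_exchange_lift:
  "natural_exchange D H \<longleftrightarrow> exchange (lift_set D) (H \<circ> drop0)"
proof
  assume nat: "natural_exchange D H"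
  show "exchange (lift_set D) (H \<circ> drop0)"
    unfolding exchange_def
  proof (intro ballI allI impI)
    fix p q N s
    assume "p \<in> lift_set D" "q \<in> lift_set D" "geodesic p q N" "s \<in># N"
    then show "\<exists>t\<in>#N - {#s#}. exchangeable (lift_set D) (H \<circ> drop0) p q (s + t)"
    proof (rule exchange_from_local[rotated 3])
      fix p q N
      assume "p \<in> lift_set D" "q \<in> lift_set D" and N: "geodesic p q N"
      then obtain x y where xy: "x \<in> D" "y \<in> D" "p = lift (parity x) x" "q = lift (parity y) y"
        by (auto simp: lift_set_def)
      obtain M where M: "geodesic x y M" and N_eq: "N = image_mset (lift 0) M +
          (if parity x = parity y then {#} else {#lift (parity y - parity x) 0#})"
        using geodesic_liftE N xy by metis
      show "even (size N)" using N_eq parity_eq_iff_even_geodesic[OF M] by auto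
      show "\<exists>t\<in>#N - {#s#}. exchangeable (lift_set D) (H \<circ> drop0) p q (s + t)"
        if "size N = 4" "s \<in># N" for s
        using natural_exchange_lift_local[OF nat] N that xy by blast
      show "\<exists>a b. {#a, b#} \<subseteq># N \<and> q - (a + b) \<in> lift_set D" if "N \<noteq> {#}"
        using natural_exchange_lift_descent[OF nat] N that xy by blast
    qed
  qed
next
  assume ex: "exchange (lift_set D) (H \<circ> drop0)"
  show "natural_exchange D H"
    unfolding natural_exchange_def
  proof (intro ballI allI impI)
    fix x y M s
    assume xy: "x \<in> D" "y \<in> D" and M: "geodesic x y M" and "s \<in># M"
    then obtain L where L: "M = add_mset s L" by (meson mset_add)
    let ?R = "if parity x = parity y then {#} else {#lift (parity y - parity x) 0#}"
    have "lift (parity x) x \<in> lift_set D" "lift (parity y) y \<in> lift_set D"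
      using xy by (simp_all add: lift_in_lift_set_iff)
    moreover have "lift 0 s \<in># image_mset (lift 0) M + ?R" using L by simp
    ultimately obtain t where t: "t \<in># image_mset (lift 0) M + ?R - {#lift 0 s#}"
      "exchangeable (lift_set D) (H \<circ> drop0) (lift (parity x) x) (lift (parity y) y) (lift 0 s + t)"
      using ex geodesic_lift[OF M] unfolding exchange_def by blast
    have "t \<in># image_mset (lift 0) L + ?R" using t(1) L by simp
    then consider u where "u \<in># L" "t = lift 0 u" | "t = lift (parity y - parity x) 0"
      by (auto split: if_splits)
    then show "exchangeable D H x y s \<or> (\<exists>t\<in>#M - {#s#}. exchangeable D H x y (s + t))"
    proof cases
      case 1
      then show ?thesis using t(2) L by (auto simp: lift_add exchangeable_lift_iff)
    next
      case 2
      then show ?thesis using t(2) by (simp add: lift_add exchangeable_lift_iff)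
    qed
  qed
qed

section \<open>Extended real functions\<close>

lemma eff_dom_exchangeable_iff:
  assumes "\<forall>x. f x \<noteq> -\<infinity>" "x \<in> eff_dom f" "y \<in> eff_dom f"
  shows "x + a \<in> eff_dom f \<and> y - a \<in> eff_dom f \<and> f (x + a) + f (y - a) \<le> f x + f y \<longleftrightarrow>
    exchangeable (eff_dom f) (real_of_ereal \<circ> f) x y a"
proof -
  have real: "f z = ereal (real_of_ereal (f z))" if "z \<in> eff_dom f" for z
    using assms(1) that by (cases "f z") (auto simp: eff_dom_def)
  have "f (x + a) + f (y - a) \<le> f x + f y \<longleftrightarrow> real_of_ereal (f (x + a)) + real_of_ereal (f (y - a))
      \<le> real_of_ereal (f x) + real_of_ereal (f y)"
    if "x + a \<in> eff_dom f" "y - a \<in> eff_dom f"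
    using real[OF that(1)] real[OF that(2)] real[OF assms(2)] real[OF assms(3)]
    by (metis ereal_less_eq(3) plus_ereal.simps(1))
  then show ?thesis by (auto simp: exchangeable_def)
qed

lemma increment_after_iff:
  assumes "geodesic x y M" "s \<in># M"
  shows "increment (x + s) y t \<longleftrightarrow> t \<in># M - {#s#}"
  using increment_iff_geodesic[OF geodesic_add_mset, of x y s "M - {#s#}"] assms by simp

lemma JM_EXC_iff_exchange:
  assumes "\<forall>x. f x \<noteq> -\<infinity>"
  shows "JM_EXC f \<longleftrightarrow> exchange (eff_dom f) (real_of_ereal \<circ> f)"
proof -
  have "(\<forall>s. increment x y s \<longrightarrow>
      (\<exists>t. increment (x + s) y t \<and> x + s + t \<in> eff_dom f \<and> y - s - t \<in> eff_dom f \<and>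
        f x + f y \<ge> f (x + s + t) + f (y - s - t))) \<longleftrightarrow>
      (\<forall>M. geodesic x y M \<longrightarrow> (\<forall>s\<in>#M. \<exists>t\<in>#M - {#s#}.
        exchangeable (eff_dom f) (real_of_ereal \<circ> f) x y (s + t)))"
    if xy: "x \<in> eff_dom f" "y \<in> eff_dom f" for x y
  proof -
    obtain M where M: "geodesic x y M" using geodesic_exists by blast
    then have "geodesic x y N \<longleftrightarrow> N = M" for N using geodesic_unique by blast
    then show ?thesis
      using increment_iff_geodesic[OF M] increment_after_iff[OF M]
      by (simp add: eff_dom_exchangeable_iff[OF assms xy, symmetric] add.assoc diff_diff_eq
          Bex_def Ball_def cong: conj_cong imp_cong)
  qed
  then show ?thesis unfolding JM_EXC_def exchange_def by simp
qed

lemma JM_nat_EXC_iff_natural_exchange: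
  assumes "\<forall>x. f x \<noteq> -\<infinity>"
  shows "JM_nat_EXC f \<longleftrightarrow> natural_exchange (eff_dom f) (real_of_ereal \<circ> f)"
proof -
  have "(\<forall>s. increment x y s \<longrightarrow>
      (x + s \<in> eff_dom f \<and> y - s \<in> eff_dom f \<and> f x + f y \<ge> f (x + s) + f (y - s)) \<or>
      (\<exists>t. increment (x + s) y t \<and> x + s + t \<in> eff_dom f \<and> y - s - t \<in> eff_dom f \<and>
        f x + f y \<ge> f (x + s + t) + f (y - s - t))) \<longleftrightarrow>
      (\<forall>M. geodesic x y M \<longrightarrow> (\<forall>s\<in>#M.
        exchangeable (eff_dom f) (real_of_ereal \<circ> f) x y s \<or>
        (\<exists>t\<in>#M - {#s#}. exchangeable (eff_dom f) (real_of_ereal \<circ> f) x y (s + t))))"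
    if xy: "x \<in> eff_dom f" "y \<in> eff_dom f" for x y
  proof -
    obtain M where M: "geodesic x y M" using geodesic_exists by blast
    then have "geodesic x y N \<longleftrightarrow> N = M" for N using geodesic_unique by blast
    then show ?thesis
      using increment_iff_geodesic[OF M] increment_after_iff[OF M]
      by (simp add: eff_dom_exchangeable_iff[OF assms xy, symmetric] add.assoc diff_diff_eq
          Bex_def Ball_def cong: conj_cong imp_cong)
  qed
  then show ?thesis unfolding JM_nat_EXC_def natural_exchange_def by simp
qed

lemma parity_lift_lift: "parity_lift f (lift e x) = (if e = parity x then f x else \<infinity>)"
  by (simp add: parity_lift_def Let_def)

lemma eff_dom_parity_lift: "eff_dom (parity_lift f) = lift_set (eff_dom f)"
proof -
  have "lift e x \<in> eff_dom (parity_lift f) \<longleftrightarrow> lift e x \<in> lift_set (eff_dom f)" for e x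
    by (auto simp: eff_dom_def lift_in_lift_set_iff parity_lift_lift)
  then show ?thesis using lift_drop0 by (metis subsetI subset_antisym)
qed

lemma exchange_cong:
  assumes "\<And>x. x \<in> D \<Longrightarrow> H x = H' x"
  shows "exchange D H \<longleftrightarrow> exchange D H'"
  using assms unfolding exchange_def exchangeable_def by (simp cong: conj_cong)

theorem theorem3p2:
  fixes f :: "int ^ 'n::finite \<Rightarrow> ereal"
  assumes "\<forall>x. f x \<noteq> -\<infinity>"
    and "eff_dom f \<noteq> {}"
  shows "(JM_nat_EXC f \<longleftrightarrow> JM_EXC (parity_lift f)) \<and>
         (jump_M_nat_convex f \<longleftrightarrow> jump_M_convex (parity_lift f))"
proof -
  have not_MInf: "\<forall>z. parity_lift f z \<noteq> -\<infinity>"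
    using assms(1) by (simp add: parity_lift_def Let_def)
  have "exchange (lift_set (eff_dom f)) (real_of_ereal \<circ> f \<circ> drop0) \<longleftrightarrow>
      exchange (lift_set (eff_dom f)) (real_of_ereal \<circ> parity_lift f)"
    by (rule exchange_cong) (auto simp: lift_set_def parity_lift_lift)
  then have iff: "JM_nat_EXC f \<longleftrightarrow> JM_EXC (parity_lift f)"
    using JM_nat_EXC_iff_natural_exchange[OF assms(1)] JM_EXC_iff_exchange[OF not_MInf]
      natural_exchange_iff_exchange_lift[of "eff_dom f" "real_of_ereal \<circ> f"]
    by (simp add: eff_dom_parity_lift)
  moreover have "proper f" "proper (parity_lift f)"
    using assms not_MInf by (simp_all add: proper_def eff_dom_parity_lift lift_set_def)
  ultimately show ?thesis by (simp add: jump_M_nat_convex_def jump_M_convex_def)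
qed

end
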